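(* Let $\mathcal{T}_{\mathcal{I}}$ be a binary cluster tree with resolution $\varrho\in\mathbb{N}$ and let $\mathcal{T}_{\mathcal{I}\times\mathcal{I}}$ be an admissible block tree for $\mathcal{T}_{\mathcal{I}}$ in which no diagonal block $(t,t)$ is an admissible leaf. Let $k\in\mathbb{N}$ be the local rank, let $C_{\text{ad}},C_{\text{mg}}\ge 0$ be constants, and let the operation counts $W_{\text{dc}}$ (LR factorization), $W_{\text{li}}$ and $W_{\text{ri}}$ (inversion of the lower and upper triangular factor), $W_{\text{in}}$ (multiplication of the inverted triangular factors) and $W_{\text{mm}}$ (matrix multiplication) be defined by the recurrences given in the context. Then $$W_{\text{dc}}(t)+W_{\text{li}}(t)+W_{\text{ri}}(t)+W_{\text{in}}(t)\le W_{\text{mm}}(t,t,t)\qquad\text{for all } t\in\mathcal{T}_{\mathcal{I}}.$$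
   Context: **Cluster tree.** Let $\mathcal{I}$ be a finite index set. A cluster tree $\mathcal{T}_{\mathcal{I}}$ is a finite rooted tree in which each node (cluster) $t$ is labeled with a subset $\hat t\subseteq\mathcal{I}$ such that the root is labeled with $\mathcal{I}$; if $t$ has sons, $\hat t=\bigcup_{t'\in\operatorname{sons}(t)}\hat t'$; and distinct sons of the same cluster have disjoint labels. $\mathcal{L}_{\mathcal{I}}$ is its set of leaves. It is binary if every non-leaf cluster $t$ has exactly two sons, listed in a fixed order as $t_1,t_2$. It has resolution $\varrho\in\mathbb{N}$ if for all $t\in\mathcal{T}_{\mathcal{I}}$: $t\in\mathcal{L}_{\mathcal{I}}\iff|\hat t|\le\varrho$. **Block tree.** A block tree $\mathcal{T}_{\mathcal{I}\times\mathcal{I}}$ for $\mathcal{T}_{\mathcal{I}}$ is a tree whose nodes (blocks) are pairs $(t,s)$ of clusters, whose root is $(r,r)$ with $r$ the root of $\mathcal{T}_{\mathcal{I}}$, and such that if a block $(t,s)$ has sons, its set of sons is $\operatorname{sons}(t)\times\operatorname{sons}(s)$. Its set of leaves $\mathcal{L}_{\mathcal{I}\times\mathcal{I}}$ is partitioned into a set $\mathcal{L}^+_{\mathcal{I}\times\mathcal{I}}$ of admissible leaves and a set $\mathcal{L}^-_{\mathcal{I}\times\mathcal{I}}$ of inadmissible leaves. The block tree is called admissible if $(t,s)\in\mathcal{L}^-_{\mathcal{I}\times\mathcal{I}}$ implies $t\in\mathcal{L}_{\mathcal{I}}$ or $s\in\mathcal{L}_{\mathcal{I}}$. **Local rank.**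 For $(t,s)\in\mathcal{L}_{\mathcal{I}\times\mathcal{I}}$ let $k_{ts}:=k$ if $(t,s)\in\mathcal{L}^+_{\mathcal{I}\times\mathcal{I}}$ and $k_{ts}:=\min\{|\hat t|,|\hat s|\}$ otherwise. **Basic operation counts.** For $(t,s)\in\mathcal{T}_{\mathcal{I}\times\mathcal{I}}$ and $\ell\in\mathbb{N}_0$: $$W_{\text{ev}}(t,s,\ell):=\begin{cases}2\ell k(|\hat t|+|\hat s|)&(t,s)\in\mathcal{L}^+_{\mathcal{I}\times\mathcal{I}},\\ \ell(2|\hat t||\hat s|+\min\{|\hat t|,|\hat s|\})&(t,s)\in\mathcal{L}^-_{\mathcal{I}\times\mathcal{I}},\\ \sum_{t'\in\operatorname{sons}(t),\,s'\in\operatorname{sons}(s)}W_{\text{ev}}(t',s',\ell)&\text{otherwise.}\end{cases}$$ For $t,s\in\mathcal{T}_{\mathcal{I}}$ and $\ell\in\mathbb{N}_0$: $$W_{\text{up}}(t,s,\ell):=\begin{cases}\sum_{t'\in\operatorname{sons}(t),\,s'\in\operatorname{sons}(s)}W_{\text{up}}(t',s',\ell)&(t,s)\in\mathcal{T}_{\mathcal{I}\times\mathcal{I}}\setminus\mathcal{L}_{\mathcal{I}\times\mathcal{I}},\\ 2\ell|\hat t||\hat s|&(t,s)\in\mathcal{L}^-_{\mathcal{I}\times\mathcal{I}},\\ C_{\text{ad}}(k+\ell)^2(|\hat t|+|\hat s|)&\text{otherwise (i.e. } (t,s)\in\mathcal{L}^+_{\mathcal{I}\times\mathcal{I}}\text{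 or }(t,s)\notin\mathcal{T}_{\mathcal{I}\times\mathcal{I}}).\end{cases}$$ For $(t,s),(s,r)\in\mathcal{T}_{\mathcal{I}\times\mathcal{I}}$: $$W_{\text{mm}}(t,s,r):=\begin{cases} W_{\text{ev}}(s,r,k_{ts})+W_{\text{up}}(t,r,k_{ts})&(t,s)\in\mathcal{L}_{\mathcal{I}\times\mathcal{I}},\\ W_{\text{ev}}(t,s,k_{sr})+W_{\text{up}}(t,r,k_{sr})&(t,s)\notin\mathcal{L}_{\mathcal{I}\times\mathcal{I}},\ (s,r)\in\mathcal{L}_{\mathcal{I}\times\mathcal{I}},\\ C_{\text{mg}}k^2(|\hat t|+|\hat r|)+\sum_{t'\in\operatorname{sons}(t),\,s'\in\operatorname{sons}(s),\,r'\in\operatorname{sons}(r)}W_{\text{mm}}(t',s',r')&\text{otherwise.}\end{cases}$$ **Triangular solves.** For $t\in\mathcal{T}_{\mathcal{I}}$, $\ell\in\mathbb{N}_0$: if $t\in\mathcal{L}_{\mathcal{I}}$, $W_{\text{ls}}(t,\ell):=W_{\text{rs}}(t,\ell):=\ell|\hat t|^2$; otherwise $$W_{\text{ls}}(t,\ell):=W_{\text{ls}}(t_1,\ell)+W_{\text{ls}}(t_2,\ell)+W_{\text{ev}}(t_2,t_1,\ell),\qquad W_{\text{rs}}(t,\ell):=W_{\text{rs}}(t_1,\ell)+W_{\text{rs}}(t_2,\ell)+W_{\text{ev}}(t_1,t_2,\ell).$$ For $(t,s)\in\mathcal{T}_{\mathcal{I}\times\mathcal{I}}$: $$W_{\text{ll}}(t,s):=\begin{cases}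 W_{\text{ls}}(t,k)&(t,s)\in\mathcal{L}^+_{\mathcal{I}\times\mathcal{I}},\\ W_{\text{ls}}(t,|\hat s|)&(t,s)\in\mathcal{L}^-_{\mathcal{I}\times\mathcal{I}},\\ \sum_{s'\in\operatorname{sons}(s)}\big(W_{\text{ll}}(t_1,s')+W_{\text{ll}}(t_2,s')+W_{\text{mm}}(t_2,t_1,s')\big)&\text{otherwise,}\end{cases}$$ $$W_{\text{rl}}(t,s):=\begin{cases} W_{\text{rs}}(t,k)&(t,s)\in\mathcal{L}^+_{\mathcal{I}\times\mathcal{I}},\\ W_{\text{rs}}(t,|\hat s|)&(t,s)\in\mathcal{L}^-_{\mathcal{I}\times\mathcal{I}},\\ \sum_{s'\in\operatorname{sons}(s)}\big(W_{\text{rl}}(t_1,s')+W_{\text{rl}}(t_2,s')+W_{\text{mm}}(t_1,t_2,s')\big)&\text{otherwise.}\end{cases}$$ For $(s,t)\in\mathcal{T}_{\mathcal{I}\times\mathcal{I}}$: $$W_{\text{lr}}(s,t):=\begin{cases} W_{\text{ls}}(t,k)&(s,t)\in\mathcal{L}^+_{\mathcal{I}\times\mathcal{I}},\\ W_{\text{ls}}(t,|\hat s|)&(s,t)\in\mathcal{L}^-_{\mathcal{I}\times\mathcal{I}},\\ \sum_{s'\in\operatorname{sons}(s)}\big(W_{\text{lr}}(s',t_1)+W_{\text{lr}}(s',t_2)+W_{\text{mm}}(s',t_2,t_1)\big)&\text{otherwise,}\end{cases}$$ $$W_{\text{rr}}(s,t):=\begin{cases} W_{\text{rs}}(t,k)&(s,t)\in\mathcal{L}^+_{\mathcal{I}\times\mathcal{I}},\\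 W_{\text{rs}}(t,|\hat s|)&(s,t)\in\mathcal{L}^-_{\mathcal{I}\times\mathcal{I}},\\ \sum_{s'\in\operatorname{sons}(s)}\big(W_{\text{rr}}(s',t_1)+W_{\text{rr}}(s',t_2)+W_{\text{mm}}(s',t_1,t_2)\big)&\text{otherwise.}\end{cases}$$ **Factorization and inversion.** For $t\in\mathcal{L}_{\mathcal{I}}$, with $n=|\hat t|$: $W_{\text{dc}}(t):=W_{\text{in}}(t):=\frac n6(4n^2-3n-1)$ and $W_{\text{li}}(t):=W_{\text{ri}}(t):=\frac n6(2n^2+4)$. For $t\in\mathcal{T}_{\mathcal{I}}\setminus\mathcal{L}_{\mathcal{I}}$: $$W_{\text{dc}}(t):=W_{\text{dc}}(t_1)+W_{\text{dc}}(t_2)+W_{\text{ll}}(t_1,t_2)+W_{\text{rr}}(t_2,t_1)+W_{\text{mm}}(t_2,t_1,t_2),$$ $$W_{\text{li}}(t):=W_{\text{ll}}(t_2,t_1)+W_{\text{lr}}(t_2,t_1)+W_{\text{li}}(t_1)+W_{\text{li}}(t_2),$$ $$W_{\text{ri}}(t):=W_{\text{rl}}(t_1,t_2)+W_{\text{rr}}(t_1,t_2)+W_{\text{ri}}(t_1)+W_{\text{ri}}(t_2),$$ $$W_{\text{in}}(t):=W_{\text{in}}(t_1)+W_{\text{in}}(t_2)+W_{\text{mm}}(t_1,t_2,t_1)+W_{\text{lr}}(t_1,t_2)+W_{\text{rl}}(t_2,t_1).$$ (Under the stated assumptions $(t,t)\in\mathcal{T}_{\mathcal{I}\times\mathcal{I}}$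 for every $t\in\mathcal{T}_{\mathcal{I}}$, so all terms are defined.) *)

theory Defs
  imports Complex_Main
begin

section \<open>Rooted trees\<close>

definition tree_edges :: "'v set \<Rightarrow> ('v \<Rightarrow> 'v set) \<Rightarrow> ('v \<times> 'v) set"
  where "tree_edges V S = {(p, c). p \<in> V \<and> c \<in> S p}"

definition rooted_tree :: "'v set \<Rightarrow> 'v \<Rightarrow> ('v \<Rightarrow> 'v set) \<Rightarrow> bool"
  where "rooted_tree V r S \<longleftrightarrow>
    finite V \<and> r \<in> V \<and>
    (\<forall>v\<in>V. S v \<subseteq> V) \<and>
    (\<forall>v\<in>V. r \<notin> S v) \<and>
    (\<forall>v\<in>V - {r}. \<exists>!p. p \<in> V \<and> v \<in> S p) \<and>
    (\<forall>v\<in>V. (r, v) \<in> (tree_edges V S)\<^sup>*)"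

definition tree_leaves :: "'v set \<Rightarrow> ('v \<Rightarrow> 'v set) \<Rightarrow> 'v set"
  where "tree_leaves V S = {v \<in> V. S v = {}}"

definition subtree_size :: "'v set \<Rightarrow> ('v \<Rightarrow> 'v set) \<Rightarrow> 'v \<Rightarrow> nat"
  where "subtree_size V S v = card ((tree_edges V S)\<^sup>* `` {v})"

lemma rooted_tree_acyclic:
  assumes "rooted_tree V r S" "v \<in> V"
  shows "(v, v) \<notin> (tree_edges V S)\<^sup>+"
proof -
  let ?E = "tree_edges V S"
  have sub: "\<And>p c. (p, c) \<in> ?E \<Longrightarrow> p \<in> V \<and> c \<in> V \<and> c \<noteq> r"
    using assms(1) by (auto simp: rooted_tree_def tree_edges_def)
  have uniq: "\<And>p q c. (p, c) \<in> ?E \<Longrightarrow> (q, c) \<in> ?E \<Longrightarrow> p = q"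
  proof -
    fix p q c assume a: "(p, c) \<in> ?E" "(q, c) \<in> ?E"
    then have "c \<in> V - {r}" using sub by blast
    then have "\<exists>!p. p \<in> V \<and> c \<in> S p" using assms(1) by (simp add: rooted_tree_def)
    then show "p = q" using a by (auto simp: tree_edges_def)
  qed
  have "(r, v) \<in> ?E\<^sup>*" using assms by (simp add: rooted_tree_def)
  then show ?thesis
  proof (induction rule: rtrancl_induct)
    case base
    show ?case
    proof
      assume "(r, r) \<in> ?E\<^sup>+"
      then obtain q where "(q, r) \<in> ?E" by (meson tranclE)
      then show False using sub by blast
    qed
  next
    case (step p c)
    show ?case
    proof
      assume "(c, c) \<in> ?E\<^sup>+"
      then obtain q where q: "(c, q) \<in> ?E\<^sup>*" "(q, c) \<in> ?E" by (meson tranclD2)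
      then have "q = p" using uniq step.hyps(2) by blast
      then have "(p, p) \<in> ?E\<^sup>+" using q step.hyps(2) by (simp add: rtrancl_into_trancl2)
      then show False using step.IH by blast
    qed
  qed
qed

lemma subtree_size_less:
  assumes "rooted_tree V r S" "v \<in> V" "c \<in> S v"
  shows "subtree_size V S c < subtree_size V S v"
proof -
  let ?E = "tree_edges V S"
  have e: "(v, c) \<in> ?E" using assms by (simp add: tree_edges_def)
  have "?E \<subseteq> V \<times> V" using assms(1) by (auto simp: rooted_tree_def tree_edges_def)
  then have "\<And>w. (v, w) \<in> ?E\<^sup>* \<Longrightarrow> w \<in> V"
    using assms(2) by (metis (no_types, lifting) mem_Sigma_iff rtranclE subsetD)
  then have "?E\<^sup>* `` {v} \<subseteq> V" by blast
  then have fin: "finite (?E\<^sup>* `` {v})"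
    using assms(1) by (auto simp: rooted_tree_def intro: finite_subset)
  have "?E\<^sup>* `` {c} \<subseteq> ?E\<^sup>* `` {v}" using e by (auto intro: converse_rtrancl_into_rtrancl)
  moreover have "v \<notin> ?E\<^sup>* `` {c}"
    using rooted_tree_acyclic[OF assms(1,2)] e by (auto dest: rtrancl_into_trancl2)
  ultimately have "?E\<^sup>* `` {c} \<subset> ?E\<^sup>* `` {v}" by blast
  then show ?thesis unfolding subtree_size_def using fin by (rule psubset_card_mono[rotated])
qed


section \<open>Cluster trees\<close>

text \<open>
  Clusters are abstract nodes rather than index sets, since different clusters may carry the
  same label. The functions \<open>son1\<close> and \<open>son2\<close> are only meaningful for binary trees.
\<close>

record ('c, 'i) ctree =
  index :: "'i set"
  clusters :: "'c set"
  root :: 'c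
  sons :: "'c \<Rightarrow> 'c set"
  label :: "'c \<Rightarrow> 'i set"
  son1 :: "'c \<Rightarrow> 'c"
  son2 :: "'c \<Rightarrow> 'c"

definition cluster_leaves :: "('c, 'i) ctree \<Rightarrow> 'c set"
  where "cluster_leaves T = tree_leaves (clusters T) (sons T)"

definition cluster_tree :: "('c, 'i) ctree \<Rightarrow> bool"
  where "cluster_tree T \<longleftrightarrow>
    finite (index T) \<and>
    rooted_tree (clusters T) (root T) (sons T) \<and>
    (\<forall>t\<in>clusters T. label T t \<subseteq> index T) \<and>
    label T (root T) = index T \<and>
    (\<forall>t\<in>clusters T. sons T t \<noteq> {} \<longrightarrow> label T t = (\<Union>t'\<in>sons T t. label T t')) \<and>
    (\<forall>t\<in>clusters T. \<forall>t'\<in>sons T t. \<forall>t''\<in>sons T t. t' \<noteq> t'' \<longrightarrow> label T t' \<inter> label T t'' = {})"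

definition binary :: "('c, 'i) ctree \<Rightarrow> bool"
  where "binary T \<longleftrightarrow>
    (\<forall>t\<in>clusters T. sons T t \<noteq> {} \<longrightarrow> son1 T t \<noteq> son2 T t \<and> sons T t = {son1 T t, son2 T t})"

definition csize :: "('c, 'i) ctree \<Rightarrow> 'c \<Rightarrow> nat"
  where "csize T t = card (label T t)"

definition has_resolution :: "('c, 'i) ctree \<Rightarrow> nat \<Rightarrow> bool"
  where "has_resolution T \<rho> \<longleftrightarrow> (\<forall>t\<in>clusters T. t \<in> cluster_leaves T \<longleftrightarrow> csize T t \<le> \<rho>)"


section \<open>Block trees\<close>

record 'c btree =
  blocks :: "('c \<times> 'c) set"
  bsons :: "'c \<times> 'c \<Rightarrow> ('c \<times> 'c) set"
  adm :: "('c \<times> 'c) set"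
  inadm :: "('c \<times> 'c) set"

definition block_leaves :: "'c btree \<Rightarrow> ('c \<times> 'c) set"
  where "block_leaves B = tree_leaves (blocks B) (bsons B)"

definition block_tree :: "('c, 'i) ctree \<Rightarrow> 'c btree \<Rightarrow> bool"
  where "block_tree T B \<longleftrightarrow>
    blocks B \<subseteq> clusters T \<times> clusters T \<and>
    rooted_tree (blocks B) (root T, root T) (bsons B) \<and>
    (\<forall>(t, s)\<in>blocks B. bsons B (t, s) \<noteq> {} \<longrightarrow> bsons B (t, s) = sons T t \<times> sons T s) \<and>
    adm B \<union> inadm B = block_leaves B \<and>
    adm B \<inter> inadm B = {}"

definition admissible :: "('c, 'i) ctree \<Rightarrow> 'c btree \<Rightarrow> bool"
  where "admissible T B \<longleftrightarrow>
    (\<forall>(t, s)\<in>inadm B. t \<in> cluster_leaves T \<or> s \<in> cluster_leaves T)"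


section \<open>Operation counts\<close>

locale hmatrix =
  fixes T :: "('c, 'i) ctree" and B :: "'c btree" and k :: nat and C_ad C_mg :: real
  assumes cluster_tree: "cluster_tree T"
    and binary: "binary T"
    and block_tree: "block_tree T B"
begin

abbreviation size_of :: "'c \<Rightarrow> nat"
  where "size_of \<equiv> csize T"

lemma subtree_size_sons:
  assumes "t \<in> clusters T" "t' \<in> sons T t"
  shows "subtree_size (clusters T) (sons T) t' < subtree_size (clusters T) (sons T) t"
  using assms cluster_tree subtree_size_less unfolding cluster_tree_def by metis

lemma subtree_size_binary:
  assumes "t \<in> clusters T" "t \<notin> cluster_leaves T"
  shows "subtree_size (clusters T) (sons T) (son1 T t) < subtree_size (clusters T) (sons T) t"
    and "subtree_size (clusters T) (sons T) (son2 T t) < subtree_size (clusters T) (sons T) t"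
proof -
  have "sons T t = {son1 T t, son2 T t}"
    using assms binary by (auto simp: binary_def cluster_leaves_def tree_leaves_def)
  then show "subtree_size (clusters T) (sons T) (son1 T t) < subtree_size (clusters T) (sons T) t"
    and "subtree_size (clusters T) (sons T) (son2 T t) < subtree_size (clusters T) (sons T) t"
    using assms subtree_size_sons by simp_all
qed

lemma block_clusters:
  assumes "(t, s) \<in> blocks B"
  shows "t \<in> clusters T" "s \<in> clusters T"
  using assms block_tree by (auto simp: block_tree_def)

lemma nonleaf_block_sons:
  assumes "(t, s) \<in> blocks B" "(t, s) \<notin> block_leaves B"
  shows "bsons B (t, s) = sons T t \<times> sons T s"
    "t \<notin> cluster_leaves T" "s \<notin> cluster_leaves T"
proof -
  have ne: "bsons B (t, s) \<noteq> {}"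
    using assms by (auto simp: block_leaves_def tree_leaves_def)
  then show eq: "bsons B (t, s) = sons T t \<times> sons T s"
    using assms block_tree by (auto simp: block_tree_def)
  show "t \<notin> cluster_leaves T" "s \<notin> cluster_leaves T"
    using ne eq by (auto simp: cluster_leaves_def tree_leaves_def)
qed

lemma block_leaves_iff: "b \<in> block_leaves B \<longleftrightarrow> b \<in> adm B \<or> b \<in> inadm B"
  using block_tree by (auto simp: block_tree_def)

text \<open>
  The counts are total functions; outside of the clusters and blocks for which they are intended
  they take the value \<open>undefined\<close>.
\<close>

definition local_rank :: "'c \<Rightarrow> 'c \<Rightarrow> nat"
  where "local_rank t s = (if (t, s) \<in> adm B then k else min (size_of t) (size_of s))"

function W_ev :: "'c \<Rightarrow> 'c \<Rightarrow> nat \<Rightarrow> real" where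
  "W_ev t s l =
    (if (t, s) \<in> adm B then 2 * real l * real k * (real (size_of t) + real (size_of s))
     else if (t, s) \<in> inadm B then
       real l * (2 * real (size_of t) * real (size_of s) + real (min (size_of t) (size_of s)))
     else if (t, s) \<in> blocks B then \<Sum>t'\<in>sons T t. \<Sum>s'\<in>sons T s. W_ev t' s' l
     else undefined)"
  by pat_completeness auto
termination
  by (relation "measure (\<lambda>(t, s, l). subtree_size (clusters T) (sons T) t)")
     (auto intro: subtree_size_sons dest: block_clusters)

text \<open>
  Unlike the other counts on pairs, \<open>W_up\<close> is needed for all pairs of clusters, including those
  that are not blocks.
\<close>

function W_up :: "'c \<Rightarrow> 'c \<Rightarrow> nat \<Rightarrow> real" where
  "W_up t s l =
    (if (t, s) \<in> blocks B - block_leaves B then \<Sum>t'\<in>sons T t. \<Sum>s'\<in>sons T s. W_up t' s' l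
     else if (t, s) \<in> inadm B then 2 * real l * real (size_of t) * real (size_of s)
     else C_ad * (real k + real l)\<^sup>2 * (real (size_of t) + real (size_of s)))"
  by pat_completeness auto
termination
  by (relation "measure (\<lambda>(t, s, l). subtree_size (clusters T) (sons T) t)")
     (auto intro: subtree_size_sons dest: block_clusters)

function W_mm :: "'c \<Rightarrow> 'c \<Rightarrow> 'c \<Rightarrow> real" where
  "W_mm t s r =
    (if (t, s) \<in> blocks B \<and> (s, r) \<in> blocks B then
       (if (t, s) \<in> block_leaves B then W_ev s r (local_rank t s) + W_up t r (local_rank t s)
        else if (s, r) \<in> block_leaves B then W_ev t s (local_rank s r) + W_up t r (local_rank s r)
        else C_mg * (real k)\<^sup>2 * (real (size_of t) + real (size_of r))
          + (\<Sum>t'\<in>sons T t. \<Sum>s'\<in>sons T s. \<Sum>r'\<in>sons T r. W_mm t' s' r'))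
     else undefined)"
  by pat_completeness auto
termination
  by (relation "measure (\<lambda>(t, s, r). subtree_size (clusters T) (sons T) t)")
     (auto intro: subtree_size_sons dest: block_clusters)

function W_ls :: "'c \<Rightarrow> nat \<Rightarrow> real" where
  "W_ls t l =
    (if t \<in> cluster_leaves T then real l * (real (size_of t))\<^sup>2
     else if t \<in> clusters T then
       W_ls (son1 T t) l + W_ls (son2 T t) l + W_ev (son2 T t) (son1 T t) l
     else undefined)"
  by pat_completeness auto
termination
  by (relation "measure (\<lambda>(t, l). subtree_size (clusters T) (sons T) t)")
     (auto intro: subtree_size_binary)

function W_rs :: "'c \<Rightarrow> nat \<Rightarrow> real" where
  "W_rs t l =
    (if t \<in> cluster_leaves T then real l * (real (size_of t))\<^sup>2
     else if t \<in> clusters T then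
       W_rs (son1 T t) l + W_rs (son2 T t) l + W_ev (son1 T t) (son2 T t) l
     else undefined)"
  by pat_completeness auto
termination
  by (relation "measure (\<lambda>(t, l). subtree_size (clusters T) (sons T) t)")
     (auto intro: subtree_size_binary)

function W_ll :: "'c \<Rightarrow> 'c \<Rightarrow> real" where
  "W_ll t s =
    (if (t, s) \<in> adm B then W_ls t k
     else if (t, s) \<in> inadm B then W_ls t (size_of s)
     else if (t, s) \<in> blocks B then
       \<Sum>s'\<in>sons T s. W_ll (son1 T t) s' + W_ll (son2 T t) s' + W_mm (son2 T t) (son1 T t) s'
     else undefined)"
  by pat_completeness auto
termination
  by (relation "measure (\<lambda>(t, s). subtree_size (clusters T) (sons T) t)")
     (auto intro!: subtree_size_binary dest: block_clusters nonleaf_block_sons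
       simp: block_leaves_iff)

function W_rl :: "'c \<Rightarrow> 'c \<Rightarrow> real" where
  "W_rl t s =
    (if (t, s) \<in> adm B then W_rs t k
     else if (t, s) \<in> inadm B then W_rs t (size_of s)
     else if (t, s) \<in> blocks B then
       \<Sum>s'\<in>sons T s. W_rl (son1 T t) s' + W_rl (son2 T t) s' + W_mm (son1 T t) (son2 T t) s'
     else undefined)"
  by pat_completeness auto
termination
  by (relation "measure (\<lambda>(t, s). subtree_size (clusters T) (sons T) t)")
     (auto intro!: subtree_size_binary dest: block_clusters nonleaf_block_sons
       simp: block_leaves_iff)

function W_lr :: "'c \<Rightarrow> 'c \<Rightarrow> real" where
  "W_lr s t =
    (if (s, t) \<in> adm B then W_ls t k
     else if (s, t) \<in> inadm B then W_ls t (size_of s)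
     else if (s, t) \<in> blocks B then
       \<Sum>s'\<in>sons T s. W_lr s' (son1 T t) + W_lr s' (son2 T t) + W_mm s' (son2 T t) (son1 T t)
     else undefined)"
  by pat_completeness auto
termination
  by (relation "measure (\<lambda>(s, t). subtree_size (clusters T) (sons T) t)")
     (auto intro!: subtree_size_binary dest: block_clusters nonleaf_block_sons
       simp: block_leaves_iff)

function W_rr :: "'c \<Rightarrow> 'c \<Rightarrow> real" where
  "W_rr s t =
    (if (s, t) \<in> adm B then W_rs t k
     else if (s, t) \<in> inadm B then W_rs t (size_of s)
     else if (s, t) \<in> blocks B then
       \<Sum>s'\<in>sons T s. W_rr s' (son1 T t) + W_rr s' (son2 T t) + W_mm s' (son1 T t) (son2 T t)
     else undefined)"
  by pat_completeness auto
termination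
  by (relation "measure (\<lambda>(s, t). subtree_size (clusters T) (sons T) t)")
     (auto intro!: subtree_size_binary dest: block_clusters nonleaf_block_sons
       simp: block_leaves_iff)

function W_dc :: "'c \<Rightarrow> real" where
  "W_dc t =
    (if t \<in> cluster_leaves T then
       real (size_of t) / 6 * (4 * (real (size_of t))\<^sup>2 - 3 * real (size_of t) - 1)
     else if t \<in> clusters T then
       W_dc (son1 T t) + W_dc (son2 T t) + W_ll (son1 T t) (son2 T t)
         + W_rr (son2 T t) (son1 T t) + W_mm (son2 T t) (son1 T t) (son2 T t)
     else undefined)"
  by pat_completeness auto
termination
  by (relation "measure (subtree_size (clusters T) (sons T))") (auto intro: subtree_size_binary)

function W_li :: "'c \<Rightarrow> real" where
  "W_li t =
    (if t \<in> cluster_leaves T then real (size_of t) / 6 * (2 * (real (size_of t))\<^sup>2 + 4)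
     else if t \<in> clusters T then
       W_ll (son2 T t) (son1 T t) + W_lr (son2 T t) (son1 T t) + W_li (son1 T t) + W_li (son2 T t)
     else undefined)"
  by pat_completeness auto
termination
  by (relation "measure (subtree_size (clusters T) (sons T))") (auto intro: subtree_size_binary)

function W_ri :: "'c \<Rightarrow> real" where
  "W_ri t =
    (if t \<in> cluster_leaves T then real (size_of t) / 6 * (2 * (real (size_of t))\<^sup>2 + 4)
     else if t \<in> clusters T then
       W_rl (son1 T t) (son2 T t) + W_rr (son1 T t) (son2 T t) + W_ri (son1 T t) + W_ri (son2 T t)
     else undefined)"
  by pat_completeness auto
termination
  by (relation "measure (subtree_size (clusters T) (sons T))") (auto intro: subtree_size_binary)

function W_in :: "'c \<Rightarrow> real" where
  "W_in t =
    (if t \<in> cluster_leaves T then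
       real (size_of t) / 6 * (4 * (real (size_of t))\<^sup>2 - 3 * real (size_of t) - 1)
     else if t \<in> clusters T then
       W_in (son1 T t) + W_in (son2 T t) + W_mm (son1 T t) (son2 T t) (son1 T t)
         + W_lr (son1 T t) (son2 T t) + W_rl (son2 T t) (son1 T t)
     else undefined)"
  by pat_completeness auto
termination
  by (relation "measure (subtree_size (clusters T) (sons T))") (auto intro: subtree_size_binary)

declare W_ev.simps [simp del] W_up.simps [simp del] W_mm.simps [simp del]
  W_ls.simps [simp del] W_rs.simps [simp del]
  W_ll.simps [simp del] W_rl.simps [simp del] W_lr.simps [simp del] W_rr.simps [simp del]
  W_dc.simps [simp del] W_li.simps [simp del] W_ri.simps [simp del] W_in.simps [simp del]

end

end

theory Submission
  imports Defs
begin

text \<open>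
  Apart from the two diagonal products, the multiplication \<open>(t, t, t)\<close> splits into six products of
  sons. Two of these occur literally in \<open>W_dc\<close> and \<open>W_in\<close>; each of the other four pays for a pair of
  triangular solves, one with a lower and one with an upper triangular matrix. The pairing works
  because a forward and a backward substitution for \<open>t\<close> together touch every leaf of the subtree
  rooted in \<open>(t, t)\<close> once off the diagonal and twice on the diagonal, and hence cost at most
  one evaluation of the block \<open>(t, t)\<close>.
\<close>

locale admissible_hmatrix = hmatrix T B k C_ad C_mg
  for T :: "('c, 'i) ctree" and B :: "'c btree" and k :: nat and C_ad C_mg :: real +
  fixes \<rho> :: nat
  assumes resolution: "has_resolution T \<rho>"
    and admissible: "admissible T B"
    and diagonal_not_adm: "t \<in> clusters T \<Longrightarrow> (t, t) \<notin> adm B"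
    and C_ad_nonneg: "C_ad \<ge> 0" and C_mg_nonneg: "C_mg \<ge> 0"
begin

section \<open>Structure of the cluster and block trees, especially along the diagonal\<close>

lemma son_in_clusters: "t \<in> clusters T \<Longrightarrow> t' \<in> sons T t \<Longrightarrow> t' \<in> clusters T"
  using cluster_tree by (auto simp: cluster_tree_def rooted_tree_def)

lemma nonleaf_sons:
  assumes "t \<in> clusters T" "t \<notin> cluster_leaves T"
  shows "sons T t = {son1 T t, son2 T t}" "son1 T t \<noteq> son2 T t"
  using assms binary by (auto simp: binary_def cluster_leaves_def tree_leaves_def)

lemma sum_sons:
  fixes f :: "'c \<Rightarrow> real"
  assumes "t \<in> clusters T" "t \<notin> cluster_leaves T"
  shows "(\<Sum>t'\<in>sons T t. f t') = f (son1 T t) + f (son2 T t)"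
  using nonleaf_sons[OF assms] by simp

lemma nonleaf_subblock:
  assumes "(t, s) \<in> blocks B" "(t, s) \<notin> block_leaves B" "t' \<in> sons T t" "s' \<in> sons T s"
  shows "(t', s') \<in> blocks B"
proof -
  have "(t', s') \<in> bsons B (t, s)"
    using nonleaf_block_sons(1)[OF assms(1,2)] assms(3,4) by simp
  then show ?thesis
    using block_tree assms(1) unfolding block_tree_def rooted_tree_def by blast
qed

lemma inadm_imp_cluster_leaf:
  "(t, s) \<in> inadm B \<Longrightarrow> t \<in> cluster_leaves T \<or> s \<in> cluster_leaves T"
  using admissible by (auto simp: admissible_def)

text \<open>Diagonal leaves are inadmissible, so admissibility of the block tree lets the
  subdivision of \<open>(t, t)\<close> stop only at a leaf cluster. Conversely, a subdivided block
  needs sons of both its clusters.\<close>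

lemma diagonal_block_leaf_iff:
  assumes "(t, t) \<in> blocks B"
  shows "(t, t) \<in> block_leaves B \<longleftrightarrow> t \<in> cluster_leaves T"
  using assms nonleaf_block_sons(2) inadm_imp_cluster_leaf diagonal_not_adm block_clusters(1)
    block_leaves_iff by blast

text \<open>Descend from the root: a cluster \<open>p\<close> with a son is no leaf, so
  \<open>(p, p)\<close> is subdivided into all pairs of sons, the diagonal ones included.\<close>

lemma diagonal_block:
  assumes "t \<in> clusters T"
  shows "(t, t) \<in> blocks B"
proof -
  have "(root T, t) \<in> (tree_edges (clusters T) (sons T))\<^sup>*"
    using cluster_tree assms by (simp add: cluster_tree_def rooted_tree_def)
  then show ?thesis
  proof (induction rule: rtrancl_induct)
    case base
    then show ?case using block_tree by (simp add: block_tree_def rooted_tree_def)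
  next
    case (step p c)
    then have "c \<in> sons T p" by (simp add: tree_edges_def)
    moreover from this have "p \<notin> cluster_leaves T"
      by (auto simp: cluster_leaves_def tree_leaves_def)
    ultimately show ?case
      using step.IH nonleaf_subblock diagonal_block_leaf_iff by blast
  qed
qed

lemma diagonal_inadm: "t \<in> clusters T \<Longrightarrow> t \<in> cluster_leaves T \<Longrightarrow> (t, t) \<in> inadm B"
  using diagonal_block diagonal_block_leaf_iff diagonal_not_adm block_leaves_iff by blast

text \<open>The resolution separates leaves from all other clusters by size. This decides which
  cluster attains the minimum in the local rank of an inadmissible block.\<close>

lemma csize_leaf_less_nonleaf:
  assumes "t \<in> clusters T" "t \<in> cluster_leaves T" "s \<in> clusters T" "s \<notin> cluster_leaves T"
  shows "csize T t < csize T s"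
  using assms resolution unfolding has_resolution_def by (metis le_less_trans not_less)

section \<open>Sign and unfolding of the basic operation counts\<close>

text \<open>Allows the update to be dropped from a product whose evaluation already pays for the
  solves.\<close>

lemma W_up_nonneg: "W_up t s l \<ge> 0"
proof (induction t s l rule: W_up.induct)
  case (1 t s l)
  then show ?case
    using C_ad_nonneg by (subst W_up.simps) (auto intro!: sum_nonneg)
qed

lemma W_ev_inadm:
  assumes "(t, s) \<in> inadm B"
  shows "W_ev t s l = real l * (2 * real (size_of t) * real (size_of s)
    + real (min (size_of t) (size_of s)))"
  using assms block_tree by (subst W_ev.simps) (auto simp: block_tree_def)

lemma W_ev_nonleaf:
  assumes "(t, s) \<in> blocks B" "(t, s) \<notin> block_leaves B"
  shows "W_ev t s l = W_ev (son1 T t) (son1 T s) l + W_ev (son1 T t) (son2 T s) l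
    + W_ev (son2 T t) (son1 T s) l + W_ev (son2 T t) (son2 T s) l"
  using assms block_clusters[OF assms(1)] nonleaf_block_sons[OF assms]
  by (subst W_ev.simps) (simp add: block_leaves_iff sum_sons)

lemma W_up_inadm:
  assumes "(t, s) \<in> inadm B"
  shows "W_up t s l = 2 * real l * real (size_of t) * real (size_of s)"
  using assms by (subst W_up.simps) (simp add: block_leaves_iff)

lemma W_mm_left_leaf:
  assumes "(t, s) \<in> blocks B" "(s, r) \<in> blocks B" "(t, s) \<in> block_leaves B"
  shows "W_mm t s r = W_ev s r (local_rank t s) + W_up t r (local_rank t s)"
  using assms by (subst W_mm.simps) simp

lemma W_mm_right_leaf:
  assumes "(t, s) \<in> blocks B" "(s, r) \<in> blocks B" "(t, s) \<notin> block_leaves B"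
    "(s, r) \<in> block_leaves B"
  shows "W_mm t s r = W_ev t s (local_rank s r) + W_up t r (local_rank s r)"
  using assms by (subst W_mm.simps) simp

text \<open>Only the nonnegative merging cost is discarded. The eight products of sons are written
  out so that each can be assigned to a separate expense.\<close>

lemma W_mm_nonleaf_ge:
  assumes "(t, s) \<in> blocks B" "(s, r) \<in> blocks B" "(t, s) \<notin> block_leaves B"
    "(s, r) \<notin> block_leaves B"
  shows "W_mm (son1 T t) (son1 T s) (son1 T r) + W_mm (son1 T t) (son1 T s) (son2 T r)
    + W_mm (son1 T t) (son2 T s) (son1 T r) + W_mm (son1 T t) (son2 T s) (son2 T r)
    + W_mm (son2 T t) (son1 T s) (son1 T r) + W_mm (son2 T t) (son1 T s) (son2 T r)
    + W_mm (son2 T t) (son2 T s) (son1 T r) + W_mm (son2 T t) (son2 T s) (son2 T r)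
    \<le> W_mm t s r"
proof -
  have "C_mg * (real k)\<^sup>2 * (real (size_of t) + real (size_of r)) \<ge> 0"
    using C_mg_nonneg by simp
  then show ?thesis
    using assms block_clusters[OF assms(1)] block_clusters[OF assms(2)]
      nonleaf_block_sons[OF assms(1,3)] nonleaf_block_sons[OF assms(2,4)]
    \<comment> \<open>The first eight occurrences of \<open>W_mm\<close> are the products of sons;
      only the ninth, the right-hand side, is unfolded.\<close>
    by (subst (9) W_mm.simps) (simp add: sum_sons)
qed

section \<open>Triangular solves\<close>

lemma W_ls_W_rs_le_W_ev:
  assumes "t \<in> clusters T"
  shows "W_ls t l + W_rs t l \<le> W_ev t t l"
  using assms
proof (induction t l rule: W_ls.induct)
  case (1 t l)
  show ?case
  proof (cases "t \<in> cluster_leaves T")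
    case True
    \<comment> \<open>With \<open>n = size_of t\<close>, the two solves cost
      \<open>2 * l * n^2\<close> against \<open>l * (2 * n^2 + n)\<close> for the
      evaluation.\<close>
    then show ?thesis
      using diagonal_inadm[OF \<open>t \<in> clusters T\<close>]
      by (simp add: W_ls.simps[of t] W_rs.simps[of t] W_ev_inadm algebra_simps power2_eq_square)
  next
    case False
    have sons: "son1 T t \<in> clusters T" "son2 T t \<in> clusters T"
      using 1(3) False nonleaf_sons(1) son_in_clusters by auto
    have "W_ev t t l = W_ev (son1 T t) (son1 T t) l + W_ev (son1 T t) (son2 T t) l
      + W_ev (son2 T t) (son1 T t) l + W_ev (son2 T t) (son2 T t) l"
      using 1(3) False W_ev_nonleaf diagonal_block diagonal_block_leaf_iff by blast
    then show ?thesis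
      using 1 False sons by (simp add: W_ls.simps[of t] W_rs.simps[of t])
  qed
qed

lemma W_ls_W_rs_leaf:
  assumes "t \<in> cluster_leaves T"
  shows "W_ls t l + W_rs t l = 2 * real l * (real (size_of t))\<^sup>2"
  using assms by (simp add: W_ls.simps[of t] W_rs.simps[of t])

text \<open>If \<open>(t, s)\<close> is a leaf, the evaluation in the product suffices. Otherwise,
  of the eight products of sons, the four with distinct sons of \<open>t\<close> occur in the two
  recurrences, and the four that repeat a son of \<open>t\<close> bound the recursive
  solves.\<close>

lemma W_ll_W_rl_le_W_mm:
  assumes "(t, s) \<in> blocks B"
  shows "W_ll t s + W_rl t s \<le> W_mm t t s"
  using assms
proof (induction t s rule: W_ll.induct)
  case (1 t s)
  note ts = block_clusters[OF \<open>(t, s) \<in> blocks B\<close>]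
  note tt = diagonal_block[OF ts(1)] diagonal_block_leaf_iff[OF diagonal_block[OF ts(1)]]
  consider "(t, s) \<in> adm B" | "(t, s) \<in> inadm B" "(t, s) \<notin> adm B"
    | "(t, s) \<notin> block_leaves B"
    using block_leaves_iff by blast
  then show ?case
  proof cases
    case adm: 1
    have solves: "W_ll t s = W_ls t k" "W_rl t s = W_rs t k"
      using adm by (simp_all add: W_ll.simps[of t] W_rl.simps[of t])
    show ?thesis
    proof (cases "t \<in> cluster_leaves T")
      case True
      \<comment> \<open>The left factor \<open>(t, t)\<close> is an inadmissible leaf: it fixes the
        rank \<open>size_of t\<close>, and \<open>(t, s)\<close> is the block evaluated.\<close>
      have "W_mm t t s = W_ev t s (size_of t) + W_up t s (size_of t)"
        using True tt 1(3) diagonal_not_adm[OF ts(1)]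
        by (simp add: W_mm_left_leaf local_rank_def)
      moreover have "W_ev t s (size_of t)
          = 2 * real (size_of t) * real k * (real (size_of t) + real (size_of s))"
        using adm by (simp add: W_ev.simps[of t s])
      moreover have "2 * real k * (real (size_of t))\<^sup>2
          \<le> 2 * real (size_of t) * real k * (real (size_of t) + real (size_of s))"
        by (simp add: algebra_simps power2_eq_square)
      ultimately show ?thesis
        using solves W_ls_W_rs_leaf[OF True, of k] W_up_nonneg[of t s "size_of t"] by linarith
    next
      case False
      have "W_mm t t s = W_ev t t k + W_up t s k"
        using False tt 1(3) adm by (simp add: W_mm_right_leaf local_rank_def block_leaves_iff)
      then show ?thesis
        using solves W_ls_W_rs_le_W_ev[OF ts(1), of k] W_up_nonneg[of t s k] by linarith
    qed
  next
    case inadm: 2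
    have solves: "W_ll t s = W_ls t (size_of s)" "W_rl t s = W_rs t (size_of s)"
      using inadm by (simp_all add: W_ll.simps[of t] W_rl.simps[of t])
    show ?thesis
    proof (cases "t \<in> cluster_leaves T")
      case True
      have "W_mm t t s = W_ev t s (size_of t) + W_up t s (size_of t)"
        using True tt 1(3) diagonal_not_adm[OF ts(1)]
        by (simp add: W_mm_left_leaf local_rank_def)
      moreover have "W_ev t s (size_of t) \<ge> 2 * real (size_of s) * (real (size_of t))\<^sup>2"
        using inadm by (simp add: W_ev_inadm algebra_simps power2_eq_square)
      ultimately show ?thesis
        using solves W_ls_W_rs_leaf[OF True, of "size_of s"] W_up_nonneg[of t s "size_of t"]
        by linarith
    next
      case False
      \<comment> \<open>Admissibility makes \<open>s\<close> a leaf, hence smaller than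
        \<open>t\<close>, so the local rank of \<open>(t, s)\<close> equals the number of right-hand
        sides.\<close>
      then have "size_of s < size_of t"
        using inadm_imp_cluster_leaf[OF inadm(1)] csize_leaf_less_nonleaf ts by blast
      then have "W_mm t t s = W_ev t t (size_of s) + W_up t s (size_of s)"
        using False tt 1(3) inadm by (simp add: W_mm_right_leaf local_rank_def block_leaves_iff)
      then show ?thesis
        using solves W_ls_W_rs_le_W_ev[OF ts(1), of "size_of s"] W_up_nonneg[of t s "size_of s"]
        by linarith
    qed
  next
    case nonleaf: 3
    note nl = nonleaf_block_sons[OF 1(3) nonleaf]
    note sons = nonleaf_sons(1)[OF ts(1) nl(2)] nonleaf_sons(1)[OF ts(2) nl(3)]
    have no: "(t, s) \<notin> adm B" "(t, s) \<notin> inadm B"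
      using nonleaf block_leaves_iff by auto
    have IH: "W_ll t' s' + W_rl t' s' \<le> W_mm t' t' s'"
      if "t' \<in> sons T t" "s' \<in> sons T s" for t' s'
    proof -
      have "(t', s') \<in> blocks B" using nonleaf_subblock[OF 1(3) nonleaf that] .
      moreover from that have "t' = son1 T t \<or> t' = son2 T t" using sons by blast
      ultimately show ?thesis using 1(1,2)[OF no 1(3) that(2)] by blast
    qed
    have "W_ll t s + W_rl t s
      = W_ll (son1 T t) (son1 T s) + W_ll (son1 T t) (son2 T s)
        + W_ll (son2 T t) (son1 T s) + W_ll (son2 T t) (son2 T s)
        + W_rl (son1 T t) (son1 T s) + W_rl (son1 T t) (son2 T s)
        + W_rl (son2 T t) (son1 T s) + W_rl (son2 T t) (son2 T s)
        + W_mm (son2 T t) (son1 T t) (son1 T s) + W_mm (son2 T t) (son1 T t) (son2 T s)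
        + W_mm (son1 T t) (son2 T t) (son1 T s) + W_mm (son1 T t) (son2 T t) (son2 T s)"
      using no 1(3) ts nl by (simp add: W_ll.simps[of t s] W_rl.simps[of t s] sum_sons)
    moreover have "(t, t) \<notin> block_leaves B" using tt nl by simp
    moreover note IH[of "son1 T t" "son1 T s"] IH[of "son1 T t" "son2 T s"]
      IH[of "son2 T t" "son1 T s"] IH[of "son2 T t" "son2 T s"]
    ultimately show ?thesis
      using W_mm_nonleaf_ge[OF tt(1) 1(3) _ nonleaf] sons by simp
  qed
qed

text \<open>Mirrors the left solves except at leaves. Here the leaf \<open>(s, t)\<close> is the
  left factor, so its rank governs the product even if \<open>t\<close> is a leaf; for an
  inadmissible leaf this rank may be \<open>size_of t\<close> although the solves are charged for
  \<open>size_of s\<close> right-hand sides.\<close>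

lemma W_lr_W_rr_le_W_mm:
  assumes "(s, t) \<in> blocks B"
  shows "W_lr s t + W_rr s t \<le> W_mm s t t"
  using assms
proof (induction s t rule: W_lr.induct)
  case (1 s t)
  note ts = block_clusters[OF \<open>(s, t) \<in> blocks B\<close>]
  note tt = diagonal_block[OF ts(2)] diagonal_block_leaf_iff[OF diagonal_block[OF ts(2)]]
  consider "(s, t) \<in> adm B" | "(s, t) \<in> inadm B" "(s, t) \<notin> adm B"
    | "(s, t) \<notin> block_leaves B"
    using block_leaves_iff by blast
  then show ?case
  proof cases
    case adm: 1
    have "W_lr s t = W_ls t k" "W_rr s t = W_rs t k"
      using adm by (simp_all add: W_lr.simps[of s] W_rr.simps[of s])
    moreover have "W_mm s t t = W_ev t t k + W_up s t k"
      using tt 1(3) adm by (simp add: W_mm_left_leaf local_rank_def block_leaves_iff)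
    ultimately show ?thesis
      using W_ls_W_rs_le_W_ev[OF ts(2), of k] W_up_nonneg[of s t k] by linarith
  next
    case inadm: 2
    let ?m = "min (size_of s) (size_of t)"
    have solves: "W_lr s t = W_ls t (size_of s)" "W_rr s t = W_rs t (size_of s)"
      using inadm by (simp_all add: W_lr.simps[of s] W_rr.simps[of s])
    have mm: "W_mm s t t = W_ev t t ?m + W_up s t ?m"
      using tt 1(3) inadm by (simp add: W_mm_left_leaf local_rank_def block_leaves_iff)
    show ?thesis
    proof (cases "size_of s \<le> size_of t")
      case True
      then show ?thesis
        using solves mm W_ls_W_rs_le_W_ev[OF ts(2), of "size_of s"]
          W_up_nonneg[of s t "size_of s"]
        by (simp add: min_absorb1)
    next
      \<comment> \<open>Here the evaluation is too cheap, but the update alone covers the solves.\<close>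
      case False
      \<comment> \<open>If \<open>t\<close> were not a leaf, \<open>s\<close> would be one and thus
        smaller than \<open>t\<close>.\<close>
      then have leaf: "t \<in> cluster_leaves T"
        using inadm_imp_cluster_leaf[OF inadm(1)] csize_leaf_less_nonleaf[OF ts(1) _ ts(2)]
        by fastforce
      have "W_up s t ?m = 2 * real (size_of s) * (real (size_of t))\<^sup>2"
        using False inadm by (simp add: W_up_inadm power2_eq_square)
      moreover have "W_ev t t ?m \<ge> 0"
        using diagonal_inadm[OF ts(2) leaf] by (simp add: W_ev_inadm)
      ultimately show ?thesis
        using solves mm W_ls_W_rs_leaf[OF leaf, of "size_of s"] by linarith
    qed
  next
    case nonleaf: 3
    note nl = nonleaf_block_sons[OF 1(3) nonleaf]
    note sons = nonleaf_sons(1)[OF ts(1) nl(2)] nonleaf_sons(1)[OF ts(2) nl(3)]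
    have no: "(s, t) \<notin> adm B" "(s, t) \<notin> inadm B"
      using nonleaf block_leaves_iff by auto
    have IH: "W_lr s' t' + W_rr s' t' \<le> W_mm s' t' t'"
      if "s' \<in> sons T s" "t' \<in> sons T t" for t' s'
    proof -
      have "(s', t') \<in> blocks B" using nonleaf_subblock[OF 1(3) nonleaf that] .
      moreover from that have "t' = son1 T t \<or> t' = son2 T t" using sons by blast
      ultimately show ?thesis using 1(1,2)[OF no 1(3) that(1)] by blast
    qed
    have "W_lr s t + W_rr s t
      = W_lr (son1 T s) (son1 T t) + W_lr (son1 T s) (son2 T t)
        + W_lr (son2 T s) (son1 T t) + W_lr (son2 T s) (son2 T t)
        + W_rr (son1 T s) (son1 T t) + W_rr (son1 T s) (son2 T t)
        + W_rr (son2 T s) (son1 T t) + W_rr (son2 T s) (son2 T t)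
        + W_mm (son1 T s) (son2 T t) (son1 T t) + W_mm (son2 T s) (son2 T t) (son1 T t)
        + W_mm (son1 T s) (son1 T t) (son2 T t) + W_mm (son2 T s) (son1 T t) (son2 T t)"
      using no 1(3) ts nl by (simp add: W_lr.simps[of s t] W_rr.simps[of s t] sum_sons)
    moreover have "(t, t) \<notin> block_leaves B" using tt nl by simp
    moreover note IH[of "son1 T s" "son1 T t"] IH[of "son1 T s" "son2 T t"]
      IH[of "son2 T s" "son1 T t"] IH[of "son2 T s" "son2 T t"]
    ultimately show ?thesis
      using W_mm_nonleaf_ge[OF 1(3) tt(1) nonleaf] sons by simp
  qed
qed

section \<open>Factorization and inversion\<close>

lemma factorization_inversion_le_W_mm:
  assumes "t \<in> clusters T"
  shows "W_dc t + W_li t + W_ri t + W_in t \<le> W_mm t t t"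
  using assms
proof (induction t rule: W_dc.induct)
  case (1 t)
  note tt = diagonal_block[OF 1(3)] diagonal_block_leaf_iff[OF diagonal_block[OF 1(3)]]
  show ?case
  proof (cases "t \<in> cluster_leaves T")
    case True
    let ?n = "real (size_of t)"
    have inadm: "(t, t) \<in> inadm B" "(t, t) \<notin> adm B"
      using diagonal_inadm[OF 1(3) True] diagonal_not_adm[OF 1(3)] by auto
    have "W_dc t + W_li t + W_ri t + W_in t = 2 * ?n ^ 3 - ?n\<^sup>2 + ?n"
      using True
      by (simp add: W_dc.simps[of t] W_li.simps[of t] W_ri.simps[of t] W_in.simps[of t]
          field_simps power2_eq_square power3_eq_cube)
    moreover have "W_mm t t t = 4 * ?n ^ 3 + ?n\<^sup>2"
      using True tt inadm
      by (simp add: W_mm_left_leaf local_rank_def W_ev_inadm W_up_inadm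
          algebra_simps power2_eq_square power3_eq_cube)
    \<comment> \<open>Valid because \<open>?n\<close> is a natural number. It absorbs the linear
      term, the only one not bounded by the same power of \<open>?n\<close> in the product.\<close>
    moreover have "?n \<le> ?n\<^sup>2"
      by (metis of_nat_le_iff of_nat_power le_square power2_eq_square)
    moreover have "?n ^ 3 \<ge> 0" by simp
    ultimately show ?thesis by (smt (verit) zero_le_power2)
  next
    case False
    note sons = nonleaf_sons(1)[OF 1(3) False]
    have nonleaf: "(t, t) \<notin> block_leaves B" using tt False by simp
    have cl: "son1 T t \<in> clusters T" "son2 T t \<in> clusters T"
      using 1(3) sons son_in_clusters by auto
    have off: "(son1 T t, son2 T t) \<in> blocks B" "(son2 T t, son1 T t) \<in> blocks B"
      using nonleaf_subblock[OF tt(1) nonleaf] sons by auto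
    \<comment> \<open>Writing 1 and 2 for the sons: products 111 and 222 pay for the recursive
      calls, 212 occurs in \<open>W_dc\<close> and 121 in \<open>W_in\<close>. Product 112 pays for
      \<open>W_ll\<close> in \<open>W_dc\<close> and \<open>W_rl\<close> in \<open>W_ri\<close>, 221
      for \<open>W_ll\<close> in \<open>W_li\<close> and \<open>W_rl\<close> in \<open>W_in\<close>,
      211 for \<open>W_lr\<close> in \<open>W_li\<close> and \<open>W_rr\<close> in
      \<open>W_dc\<close>, 122 for \<open>W_lr\<close> in \<open>W_in\<close> and
      \<open>W_rr\<close> in \<open>W_ri\<close>.\<close>
    show ?thesis
      using W_mm_nonleaf_ge[OF tt(1) tt(1) nonleaf nonleaf]
        1(1)[OF False 1(3) cl(1)] 1(2)[OF False 1(3) cl(2)]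
        W_ll_W_rl_le_W_mm[OF off(1)] W_ll_W_rl_le_W_mm[OF off(2)]
        W_lr_W_rr_le_W_mm[OF off(1)] W_lr_W_rr_le_W_mm[OF off(2)]
        False 1(3)
      by (simp add: W_dc.simps[of t] W_li.simps[of t] W_ri.simps[of t] W_in.simps[of t])
  qed
qed

end

theorem theorem7:
  fixes T :: "('c, 'i) ctree" and B :: "'c btree"
    and \<rho> k :: nat and C_ad C_mg :: real
  assumes "cluster_tree T" and "binary T"
    and "\<rho> > 0" and "has_resolution T \<rho>"
    and "block_tree T B" and "admissible T B"
    and "\<forall>t\<in>clusters T. (t, t) \<notin> adm B"
    and "k > 0" and "C_ad \<ge> 0" and "C_mg \<ge> 0"
  shows "\<forall>t\<in>clusters T.
    hmatrix.W_dc T B k C_ad C_mg t + hmatrix.W_li T B k C_ad C_mg t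
      + hmatrix.W_ri T B k C_ad C_mg t + hmatrix.W_in T B k C_ad C_mg t
    \<le> hmatrix.W_mm T B k C_ad C_mg t t t"
proof -
  interpret admissible_hmatrix T B k C_ad C_mg \<rho>
    using assms by unfold_locales auto
  show ?thesis using factorization_inversion_le_W_mm by blast
qed

end
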